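(* Let $M$ be a non-zero left $R$-module that is a top$^{\mathrm{fc}}$-module. If $M$ is an Artinian $R$-module, then the topological space $\mathbf{Z}^{\mathrm{fc}}(M)$ is Noetherian. If $M$ is a Noetherian $R$-module, then the topological space $\mathbf{Z}^{\mathrm{fc}}(M)$ is Artinian.
   Context: $R$ is an associative (not necessarily commutative) ring with $1_R\neq 0_R$ and modules are unital left $R$-modules; $L\leq_R M$ means that $L$ is an $R$-submodule of $M$. A submodule $L\leq_R M$ is fully invariant if $f(L)\subseteq L$ for every $R$-linear endomorphism $f$ of $M$. For $X,Y\leq_R M$ put $\mathrm{An}(X)=\{f\in \mathrm{End}_R(M)\mid f(X)=0\}$ and $X\odot_M Y=\bigcap_{f\in\mathrm{An}(X)} f^{-1}(Y)$. A non-zero fully invariant submodule $K$ of $M$ is fully coprime in $M$ if for all fully invariant submodules $X,Y$ of $M$: $K\subseteq X\odot_M Y$ implies $K\subseteq X$ or $K\subseteq Y$. $\mathrm{Spec}^{\mathrm{fc}}(M)$ is the (possibly empty) set of all non-zero fully invariant submodules of $M$ that are fully coprime in $M$. For $L\leq_R M$ put $\mathcal{V}^{\mathrm{fc}}(L)=\{K\in\mathrm{Spec}^{\mathrm{fc}}(M)\mid K\subseteq L\}$ and $\mathcal{X}^{\mathrm{fc}}(L)=\{K\in\mathrm{Spec}^{\mathrm{fc}}(M)\mid K\not\subseteq L\}$. $M$ is a top$^{\mathrm{fc}}$-module if $\{\mathcal{V}^{\mathrm{fc}}(L)\mid L\leq_R M\}$ is closed under finite unions; in that case $\mathbf{Z}^{\mathrm{fc}}(M)$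 denotes the topological space $\mathrm{Spec}^{\mathrm{fc}}(M)$ with open sets $\mathcal{X}^{\mathrm{fc}}(L)$, $L\leq_R M$ (closed sets $\mathcal{V}^{\mathrm{fc}}(L)$). A topological space is Noetherian (Artinian) if every ascending (descending) chain of open sets is stationary, equivalently every descending (ascending) chain of closed sets is stationary. *)

theory Defs
  imports "HOL-Algebra.Module" "HOL-Analysis.Abstract_Topology"
begin

text \<open>
  The locale \<open>module\<close> of HOL-Algebra requires a commutative ring of scalars. The following
  locale has the same axioms over an arbitrary associative unital ring, so it describes unital left
  modules. The HOL-Algebra locale \<open>submodule\<close> does not mention commutativity and is used as it is.
\<close>

locale left_module = R?: ring R + M?: abelian_group M for R (structure) and M (structure) +
  assumes smult_closed [simp, intro]:
      "\<lbrakk>a \<in> carrier R; x \<in> carrier M\<rbrakk> \<Longrightarrow> a \<odot>\<^bsub>M\<^esub> x \<in> carrier M"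
    and smult_l_distr:
      "\<lbrakk>a \<in> carrier R; b \<in> carrier R; x \<in> carrier M\<rbrakk> \<Longrightarrow>
        (a \<oplus> b) \<odot>\<^bsub>M\<^esub> x = a \<odot>\<^bsub>M\<^esub> x \<oplus>\<^bsub>M\<^esub> b \<odot>\<^bsub>M\<^esub> x"
    and smult_r_distr:
      "\<lbrakk>a \<in> carrier R; x \<in> carrier M; y \<in> carrier M\<rbrakk> \<Longrightarrow>
        a \<odot>\<^bsub>M\<^esub> (x \<oplus>\<^bsub>M\<^esub> y) = a \<odot>\<^bsub>M\<^esub> x \<oplus>\<^bsub>M\<^esub> a \<odot>\<^bsub>M\<^esub> y"
    and smult_assoc1:
      "\<lbrakk>a \<in> carrier R; b \<in> carrier R; x \<in> carrier M\<rbrakk> \<Longrightarrow>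
        (a \<otimes> b) \<odot>\<^bsub>M\<^esub> x = a \<odot>\<^bsub>M\<^esub> (b \<odot>\<^bsub>M\<^esub> x)"
    and smult_one [simp]:
      "x \<in> carrier M \<Longrightarrow> \<one> \<odot>\<^bsub>M\<^esub> x = x"

text \<open>
  As for \<open>hom\<close>, the values of an endomorphism outside the carrier are left open; everything below
  depends only on the values on the carrier.
\<close>

definition module_End :: "('a, 'm) ring_scheme \<Rightarrow> ('a, 'b, 'n) module_scheme \<Rightarrow> ('b \<Rightarrow> 'b) set"
  where "module_End R M =
    {f \<in> hom (add_monoid M) (add_monoid M).
      \<forall>a \<in> carrier R. \<forall>x \<in> carrier M. f (a \<odot>\<^bsub>M\<^esub> x) = a \<odot>\<^bsub>M\<^esub> f x}"

definition fully_invariant :: "('a, 'm) ring_scheme \<Rightarrow> ('a, 'b, 'n) module_scheme \<Rightarrow> 'b set \<Rightarrow> bool"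
  where "fully_invariant R M L \<longleftrightarrow> submodule L R M \<and> (\<forall>f \<in> module_End R M. f ` L \<subseteq> L)"

definition An :: "('a, 'm) ring_scheme \<Rightarrow> ('a, 'b, 'n) module_scheme \<Rightarrow> 'b set \<Rightarrow> ('b \<Rightarrow> 'b) set"
  where "An R M X = {f \<in> module_End R M. \<forall>x \<in> X. f x = \<zero>\<^bsub>M\<^esub>}"

definition internal_coproduct ::
    "('a, 'm) ring_scheme \<Rightarrow> ('a, 'b, 'n) module_scheme \<Rightarrow> 'b set \<Rightarrow> 'b set \<Rightarrow> 'b set"
  where "internal_coproduct R M X Y = (\<Inter>f \<in> An R M X. {x \<in> carrier M. f x \<in> Y})"

definition fully_coprime :: "('a, 'm) ring_scheme \<Rightarrow> ('a, 'b, 'n) module_scheme \<Rightarrow> 'b set \<Rightarrow> bool"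
  where "fully_coprime R M K \<longleftrightarrow>
    fully_invariant R M K \<and> K \<noteq> {\<zero>\<^bsub>M\<^esub>} \<and>
    (\<forall>X Y. fully_invariant R M X \<and> fully_invariant R M Y \<longrightarrow>
      K \<subseteq> internal_coproduct R M X Y \<longrightarrow> K \<subseteq> X \<or> K \<subseteq> Y)"

definition Spec_fc :: "('a, 'm) ring_scheme \<Rightarrow> ('a, 'b, 'n) module_scheme \<Rightarrow> 'b set set"
  where "Spec_fc R M = {K. fully_coprime R M K}"

definition V_fc :: "('a, 'm) ring_scheme \<Rightarrow> ('a, 'b, 'n) module_scheme \<Rightarrow> 'b set \<Rightarrow> 'b set set"
  where "V_fc R M L = {K \<in> Spec_fc R M. K \<subseteq> L}"

definition X_fc :: "('a, 'm) ring_scheme \<Rightarrow> ('a, 'b, 'n) module_scheme \<Rightarrow> 'b set \<Rightarrow> 'b set set"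
  where "X_fc R M L = {K \<in> Spec_fc R M. \<not> K \<subseteq> L}"

definition top_fc_module :: "('a, 'm) ring_scheme \<Rightarrow> ('a, 'b, 'n) module_scheme \<Rightarrow> bool"
  where "top_fc_module R M \<longleftrightarrow>
    (\<forall>\<F>. finite \<F> \<and> \<F> \<subseteq> {V_fc R M L | L. submodule L R M} \<longrightarrow>
      \<Union>\<F> \<in> {V_fc R M L | L. submodule L R M})"

text \<open>
  The following is meaningful only for a module satisfying \<open>top_fc_module\<close>; lemma
  \<open>openin_Z_fc\<close> below shows that its open sets are then as prescribed.
\<close>

definition Z_fc :: "('a, 'm) ring_scheme \<Rightarrow> ('a, 'b, 'n) module_scheme \<Rightarrow> 'b set topology"
  where "Z_fc R M = topology (\<lambda>U. \<exists>L. submodule L R M \<and> U = X_fc R M L)"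

definition ascending_chain_condition :: "'a set set \<Rightarrow> bool"
  where "ascending_chain_condition \<C> \<longleftrightarrow>
    (\<forall>C :: nat \<Rightarrow> 'a set. (\<forall>n. C n \<in> \<C>) \<and> (\<forall>n. C n \<subseteq> C (Suc n)) \<longrightarrow>
      (\<exists>N. \<forall>n\<ge>N. C n = C N))"

definition descending_chain_condition :: "'a set set \<Rightarrow> bool"
  where "descending_chain_condition \<C> \<longleftrightarrow>
    (\<forall>C :: nat \<Rightarrow> 'a set. (\<forall>n. C n \<in> \<C>) \<and> (\<forall>n. C (Suc n) \<subseteq> C n) \<longrightarrow>
      (\<exists>N. \<forall>n\<ge>N. C n = C N))"

definition noetherian_module :: "('a, 'm) ring_scheme \<Rightarrow> ('a, 'b, 'n) module_scheme \<Rightarrow> bool"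
  where "noetherian_module R M \<longleftrightarrow> ascending_chain_condition {L. submodule L R M}"

definition artinian_module :: "('a, 'm) ring_scheme \<Rightarrow> ('a, 'b, 'n) module_scheme \<Rightarrow> bool"
  where "artinian_module R M \<longleftrightarrow> descending_chain_condition {L. submodule L R M}"

definition noetherian_space :: "'a topology \<Rightarrow> bool"
  where "noetherian_space T \<longleftrightarrow> ascending_chain_condition {U. openin T U}"

definition artinian_space :: "'a topology \<Rightarrow> bool"
  where "artinian_space T \<longleftrightarrow> descending_chain_condition {U. openin T U}"


lemma (in left_module) submodule_carrier: "submodule (carrier M) R M"
  by (simp add: submodule_def submodule_axioms_def add.subgroup_self)

lemma (in left_module) submodule_Inter:
  assumes "\<L> \<noteq> {}" and "\<And>L. L \<in> \<L> \<Longrightarrow> submodule L R M"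
  shows "submodule (\<Inter>\<L>) R M"
  using assms add.subgroups_Inter[of \<L>]
  unfolding submodule_def submodule_axioms_def by auto

lemma (in left_module) istopology_X_fc:
  assumes top: "top_fc_module R M"
  shows "istopology (\<lambda>U. \<exists>L. submodule L R M \<and> U = X_fc R M L)"
  unfolding istopology_def
proof (intro conjI allI impI)
  fix S T
  assume "\<exists>L. submodule L R M \<and> S = X_fc R M L" and "\<exists>L. submodule L R M \<and> T = X_fc R M L"
  then obtain L L' where L: "submodule L R M" "S = X_fc R M L"
    and L': "submodule L' R M" "T = X_fc R M L'" by blast
  have "\<Union>{V_fc R M L, V_fc R M L'} \<in> {V_fc R M L | L. submodule L R M}"
    by (rule top[unfolded top_fc_module_def, rule_format]) (use L(1) L'(1) in auto)
  then obtain N where N: "submodule N R M" "V_fc R M L \<union> V_fc R M L' = V_fc R M N" by auto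
  have "X_fc R M L \<inter> X_fc R M L' = Spec_fc R M - (V_fc R M L \<union> V_fc R M L')"
    by (auto simp: X_fc_def V_fc_def)
  also have "\<dots> = X_fc R M N" unfolding N(2) by (auto simp: X_fc_def V_fc_def)
  finally show "\<exists>L. submodule L R M \<and> S \<inter> T = X_fc R M L" using N(1) L(2) L'(2) by blast
next
  fix \<K>
  assume K: "\<forall>U\<in>\<K>. \<exists>L. submodule L R M \<and> U = X_fc R M L"
  then obtain l where l: "\<And>U. U \<in> \<K> \<Longrightarrow> submodule (l U) R M \<and> U = X_fc R M (l U)" by metis
  let ?N = "\<Inter>(insert (carrier M) (l ` \<K>))"
  have N: "submodule ?N R M"
    by (rule submodule_Inter) (use l submodule_carrier in auto)
  have sub: "K \<subseteq> carrier M" if "K \<in> Spec_fc R M" for K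
    using that subgroup.subset[of K "add_monoid M"]
    by (simp add: Spec_fc_def fully_coprime_def fully_invariant_def submodule_def)
  have "\<Union>\<K> = (\<Union>U\<in>\<K>. X_fc R M (l U))" using l by auto
  also have "\<dots> = X_fc R M ?N" unfolding X_fc_def using sub by blast
  finally show "\<exists>L. submodule L R M \<and> \<Union>\<K> = X_fc R M L" using N by blast
qed

lemma (in left_module) openin_Z_fc:
  assumes "top_fc_module R M"
  shows "openin (Z_fc R M) U \<longleftrightarrow> (\<exists>L. submodule L R M \<and> U = X_fc R M L)"
  unfolding Z_fc_def by (simp add: istopology_X_fc[OF assms])

lemma (in left_module) topspace_Z_fc:
  assumes "top_fc_module R M"
  shows "topspace (Z_fc R M) = Spec_fc R M"
proof -
  have smult_zero: "a \<odot>\<^bsub>M\<^esub> \<zero>\<^bsub>M\<^esub> = \<zero>\<^bsub>M\<^esub>" if "a \<in> carrier R" for a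
  proof -
    have "a \<odot>\<^bsub>M\<^esub> \<zero>\<^bsub>M\<^esub> \<oplus>\<^bsub>M\<^esub> a \<odot>\<^bsub>M\<^esub> \<zero>\<^bsub>M\<^esub> = a \<odot>\<^bsub>M\<^esub> \<zero>\<^bsub>M\<^esub>"
      using smult_r_distr[OF that M.zero_closed M.zero_closed] by simp
    then show ?thesis
      using that by (simp add: M.add.l_cancel_one)
  qed
  have "submodule {\<zero>\<^bsub>M\<^esub>} R M"
    using add.triv_subgroup by (simp add: submodule_def submodule_axioms_def smult_zero)
  moreover have "X_fc R M {\<zero>\<^bsub>M\<^esub>} = Spec_fc R M"
  proof -
    have "\<not> K \<subseteq> {\<zero>\<^bsub>M\<^esub>}" if "K \<in> Spec_fc R M" for K
    proof -
      have "K \<noteq> {\<zero>\<^bsub>M\<^esub>}" and "subgroup K (add_monoid M)"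
        using that by (simp_all add: Spec_fc_def fully_coprime_def fully_invariant_def submodule_def)
      then show ?thesis using subgroup.one_closed[of K "add_monoid M"] by auto
    qed
    then show ?thesis by (auto simp: X_fc_def)
  qed
  ultimately have "openin (Z_fc R M) (Spec_fc R M)"
    using openin_Z_fc[OF assms] by blast
  moreover have "U \<subseteq> Spec_fc R M" if "openin (Z_fc R M) U" for U
    using that openin_Z_fc[OF assms] unfolding X_fc_def by blast
  ultimately show ?thesis
    unfolding topspace_def by blast
qed

end

theory Submission
  imports Defs
begin

text \<open>
  An open set \<open>U\<close> of the spectrum can be recovered from a submodule that is chosen
  order-reversingly in \<open>U\<close>: take the smallest submodule \<open>H\<close> that contains all fully coprime
  submodules outside \<open>U\<close>. If \<open>U\<close> is the open set of a submodule \<open>L\<close>, then the points outside \<open>U\<close>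
  are exactly the fully coprime submodules below \<open>L\<close>, so \<open>H \<subseteq> L\<close>; hence a fully coprime submodule
  lies below \<open>H\<close> if and only if it lies below \<open>L\<close>, and \<open>H\<close> again defines \<open>U\<close>
  (lemma \<open>X_fc_spec_hull\<close>). The lattice of open sets is therefore embedded, with reversed order,
  in the lattice of submodules. A chain of open sets becomes a chain of submodules in the opposite
  direction, and it is stationary as soon as the latter is
  (lemmas \<open>ascending_chain_condition_antimono\<close> and \<open>descending_chain_condition_antimono\<close>).
\<close>

lemma ascending_chain_condition_antimono:
  fixes \<C> :: "'a set set" and \<D> :: "'b set set"
  assumes dcc: "descending_chain_condition \<D>"
    and maps: "\<And>U. U \<in> \<C> \<Longrightarrow> h U \<in> \<D>"
    and anti: "\<And>U U'. U \<subseteq> U' \<Longrightarrow> h U' \<subseteq> h U"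
    and inv: "\<And>U. U \<in> \<C> \<Longrightarrow> g (h U) = U"
  shows "ascending_chain_condition \<C>"
  unfolding ascending_chain_condition_def
proof (intro allI impI, elim conjE)
  fix C :: "nat \<Rightarrow> 'a set"
  assume C: "\<forall>n. C n \<in> \<C>" and chain: "\<forall>n. C n \<subseteq> C (Suc n)"
  have "\<forall>n. h (C n) \<in> \<D>" "\<forall>n. h (C (Suc n)) \<subseteq> h (C n)"
    using C chain maps anti by auto
  then obtain N where "\<forall>n\<ge>N. h (C n) = h (C N)"
    using dcc[unfolded descending_chain_condition_def, rule_format, of "\<lambda>n. h (C n)"] by auto
  then show "\<exists>N. \<forall>n\<ge>N. C n = C N"
    using C inv by metis
qed

lemma descending_chain_condition_antimono:
  fixes \<C> :: "'a set set" and \<D> :: "'b set set"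
  assumes acc: "ascending_chain_condition \<D>"
    and maps: "\<And>U. U \<in> \<C> \<Longrightarrow> h U \<in> \<D>"
    and anti: "\<And>U U'. U \<subseteq> U' \<Longrightarrow> h U' \<subseteq> h U"
    and inv: "\<And>U. U \<in> \<C> \<Longrightarrow> g (h U) = U"
  shows "descending_chain_condition \<C>"
  unfolding descending_chain_condition_def
proof (intro allI impI, elim conjE)
  fix C :: "nat \<Rightarrow> 'a set"
  assume C: "\<forall>n. C n \<in> \<C>" and chain: "\<forall>n. C (Suc n) \<subseteq> C n"
  have "\<forall>n. h (C n) \<in> \<D>" "\<forall>n. h (C n) \<subseteq> h (C (Suc n))"
    using C chain maps anti by auto
  then obtain N where "\<forall>n\<ge>N. h (C n) = h (C N)"
    using acc[unfolded ascending_chain_condition_def, rule_format, of "\<lambda>n. h (C n)"] by auto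
  then show "\<exists>N. \<forall>n\<ge>N. C n = C N"
    using C inv by metis
qed

text \<open>
  This is the sum of the fully coprime submodules outside \<open>U\<close>, written as an intersection so that
  its minimality is immediate.
\<close>

definition spec_hull ::
    "('a, 'm) ring_scheme \<Rightarrow> ('a, 'b, 'n) module_scheme \<Rightarrow> 'b set set \<Rightarrow> 'b set"
  where "spec_hull R M U = \<Inter>{L. submodule L R M \<and> (\<forall>K \<in> Spec_fc R M - U. K \<subseteq> L)}"

lemma spec_hull_antimono: "U \<subseteq> U' \<Longrightarrow> spec_hull R M U' \<subseteq> spec_hull R M U"
  unfolding spec_hull_def by blast

lemma (in left_module) submodule_spec_hull: "submodule (spec_hull R M U) R M"
  unfolding spec_hull_def
proof (rule submodule_Inter)
  have "K \<subseteq> carrier M" if "K \<in> Spec_fc R M" for K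
    using that subgroup.subset[of K "add_monoid M"]
    by (simp add: Spec_fc_def fully_coprime_def fully_invariant_def submodule_def)
  then show "{L. submodule L R M \<and> (\<forall>K \<in> Spec_fc R M - U. K \<subseteq> L)} \<noteq> {}"
    using submodule_carrier by blast
qed blast

text \<open>
  The hull \<open>H\<close> of \<open>X_fc R M L\<close> contains every fully coprime submodule below \<open>L\<close> by construction.
  Conversely \<open>L\<close> competes in the intersection defining \<open>H\<close>, so \<open>H \<subseteq> L\<close> and \<open>H\<close> contains no others.
\<close>

lemma X_fc_spec_hull:
  assumes "submodule L R M"
  shows "X_fc R M (spec_hull R M (X_fc R M L)) = X_fc R M L"
proof -
  have "spec_hull R M (X_fc R M L) \<subseteq> L"
    using assms unfolding spec_hull_def X_fc_def by blast
  moreover have "K \<subseteq> spec_hull R M (X_fc R M L)" if "K \<in> Spec_fc R M" "K \<subseteq> L" for K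
    using that unfolding spec_hull_def X_fc_def by blast
  ultimately show ?thesis
    unfolding X_fc_def by blast
qed

theorem theorem3p24:
  fixes R :: "('a, 'm) ring_scheme" and M :: "('a, 'b, 'n) module_scheme"
  assumes "left_module R M"
    and "\<one>\<^bsub>R\<^esub> \<noteq> \<zero>\<^bsub>R\<^esub>"
    and "carrier M \<noteq> {\<zero>\<^bsub>M\<^esub>}"
    and "top_fc_module R M"
  shows "(artinian_module R M \<longrightarrow> noetherian_space (Z_fc R M)) \<and>
    (noetherian_module R M \<longrightarrow> artinian_space (Z_fc R M))"
proof -
  interpret left_module R M by fact
  have maps: "spec_hull R M U \<in> {L. submodule L R M}" for U
    using submodule_spec_hull by simp
  have inv: "X_fc R M (spec_hull R M U) = U" if "U \<in> {U. openin (Z_fc R M) U}" for U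
  proof -
    from that obtain L where "submodule L R M" "U = X_fc R M L"
      using openin_Z_fc[OF assms(4)] by blast
    then show ?thesis
      by (simp add: X_fc_spec_hull)
  qed
  show ?thesis
    unfolding artinian_module_def noetherian_module_def noetherian_space_def artinian_space_def
  proof (intro conjI impI)
    assume "descending_chain_condition {L. submodule L R M}"
    then show "ascending_chain_condition {U. openin (Z_fc R M) U}"
      by (rule ascending_chain_condition_antimono[where h = "spec_hull R M" and g = "X_fc R M"])
        (rule maps, erule spec_hull_antimono, erule inv)
  next
    assume "ascending_chain_condition {L. submodule L R M}"
    then show "descending_chain_condition {U. openin (Z_fc R M) U}"
      by (rule descending_chain_condition_antimono[where h = "spec_hull R M" and g = "X_fc R M"])
        (rule maps, erule spec_hull_antimono, erule inv)
  qed
qed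

end
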